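(* Let $(\mathbb A,\mathsf E,\mathsf M)$ be a context. If $f:X\to Y$ is a Frobenius morphism in $\mathsf E$ which reflects zero, and $\phi$ is a preneighbourhood system on $Y$, then $f\in\mathtt{Cl}(f^{\leftarrow}\phi\exists_f,\phi)$.
   Context: A context is a triple $(\mathbb A,\mathsf E,\mathsf M)$ where $\mathbb A$ is a finitely complete category with finite coproducts, $(\mathsf E,\mathsf M)$ is a proper factorization system on $\mathbb A$ ($\mathsf E\subseteq$ epimorphisms, $\mathsf M\subseteq$ monomorphisms), and for each object $X$ the poset $\mathrm{Sub}(X)$ of admissible subobjects of $X$ ($\mathsf M$-morphisms with codomain $X$, equivalent ones identified) is a complete lattice, with largest element $\mathrm{id}_X$ and smallest element $\sigma_X$ (the $\mathsf M$-part of the factorization of the unique morphism from the initial object to $X$). For $f:X\to Y$, $\exists_f m$ is the $\mathsf M$-part of the factorization of $f\circ m$ ($m\in\mathrm{Sub}(X)$) and $f^{-1}n$ is the pullback of $n\in\mathrm{Sub}(Y)$ along $f$. $f$ is a Frobenius morphism if $\exists_f(x\wedge f^{-1}y)=y\wedge\exists_f x$ for all $x\in\mathrm{Sub}(X)$, $y\in\mathrm{Sub}(Y)$; $f$ reflects zero if $f^{-1}\sigma_Y=\sigma_X$. A filter on $X$ is an up-closed subset of $\mathrm{Sub}(X)$ closed under finite meets; filters $\mathrm{Fil}(X)$ are ordered by inclusion. A preneighbourhood system on $X$ is an order preserving map $\mu:\mathrm{Sub}(X)^{\mathrm{op}}\to\mathrm{Fil}(X)$ with $\mu(\sigma_X)=\mathrm{Sub}(X)$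 and $p\in\mu(m)\Rightarrow m\leq p$. For a filter $B$ on $Y$, $f^{\leftarrow}B=\{x\in\mathrm{Sub}(X):(\exists b\in B)(f^{-1}b\leq x)\}$; $f^{\leftarrow}\phi\exists_f$ denotes the preneighbourhood system $x\mapsto f^{\leftarrow}(\phi(\exists_f x))$ on $X$. Define $\mathtt{Far}_\mu p=\{x\in\mathrm{Sub}(X):(\exists u\in\mu(x))(u\wedge p=\sigma_X)\}$, $\mathrm{cl}_\mu p=\bigvee\{x\in\mathrm{Sub}(X): p\not< x\text{ and }x\notin\mathtt{Far}_\mu p\}$, $\mathfrak C_\mu=\{p:\mathrm{cl}_\mu p=p\}$, and $\widehat{\mathrm{cl}}_\mu p=\bigwedge\{t\in\mathfrak C_\mu: p\leq t\}$. For preneighbourhood systems $\mu$ on $X$ and $\phi$ on $Y$, $\mathtt{Cl}(\mu,\phi)$ is the set of morphisms $f:X\to Y$ such that $\mu\supseteq f^{\leftarrow}\phi\exists_f$ (pointwise) and $\widehat{\mathrm{cl}}_\phi(\exists_f p)\leq\exists_f(\widehat{\mathrm{cl}}_\mu p)$ for all $p\in\mathrm{Sub}(X)$. *)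

theory Defs
  imports "HOL-Algebra.Complete_Lattice"
begin

section \<open>Categories\<close>

text \<open>\<open>Comp C g f\<close> is the composite ``g after f''; it is only meaningful for composable pairs.\<close>

record ('o, 'a) category =
  Obj :: "'o set"
  Arr :: "'a set"
  Dom :: "'a \<Rightarrow> 'o"
  Cod :: "'a \<Rightarrow> 'o"
  Ide :: "'o \<Rightarrow> 'a"
  Comp :: "'a \<Rightarrow> 'a \<Rightarrow> 'a"  (infixr \<open>\<cdot>\<index>\<close> 70)

definition Hom :: "('o, 'a, 'z) category_scheme \<Rightarrow> 'o \<Rightarrow> 'o \<Rightarrow> 'a set" where
  "Hom C X Y = {f \<in> Arr C. Dom C f = X \<and> Cod C f = Y}"

locale category =
  fixes C :: "('o, 'a, 'z) category_scheme" (structure)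
  assumes Dom_in_Obj: "f \<in> Arr C \<Longrightarrow> Dom C f \<in> Obj C"
    and Cod_in_Obj: "f \<in> Arr C \<Longrightarrow> Cod C f \<in> Obj C"
    and Ide_in_Hom: "X \<in> Obj C \<Longrightarrow> Ide C X \<in> Hom C X X"
    and Comp_in_Hom: "f \<in> Hom C X Y \<Longrightarrow> g \<in> Hom C Y Z \<Longrightarrow> g \<cdot> f \<in> Hom C X Z"
    and Comp_Ide: "f \<in> Hom C X Y \<Longrightarrow> f \<cdot> Ide C X = f"
    and Ide_Comp: "f \<in> Hom C X Y \<Longrightarrow> Ide C Y \<cdot> f = f"
    and Comp_assoc: "f \<in> Hom C X Y \<Longrightarrow> g \<in> Hom C Y Z \<Longrightarrow> h \<in> Hom C Z W
      \<Longrightarrow> (h \<cdot> g) \<cdot> f = h \<cdot> (g \<cdot> f)"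

definition is_mono :: "('o, 'a, 'z) category_scheme \<Rightarrow> 'a \<Rightarrow> bool" where
  "is_mono C m \<longleftrightarrow> m \<in> Arr C \<and>
     (\<forall>W. \<forall>g \<in> Hom C W (Dom C m). \<forall>h \<in> Hom C W (Dom C m).
        m \<cdot>\<^bsub>C\<^esub> g = m \<cdot>\<^bsub>C\<^esub> h \<longrightarrow> g = h)"

definition is_epi :: "('o, 'a, 'z) category_scheme \<Rightarrow> 'a \<Rightarrow> bool" where
  "is_epi C e \<longleftrightarrow> e \<in> Arr C \<and>
     (\<forall>W. \<forall>g \<in> Hom C (Cod C e) W. \<forall>h \<in> Hom C (Cod C e) W.
        g \<cdot>\<^bsub>C\<^esub> e = h \<cdot>\<^bsub>C\<^esub> e \<longrightarrow> g = h)"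

definition is_iso :: "('o, 'a, 'z) category_scheme \<Rightarrow> 'a \<Rightarrow> bool" where
  "is_iso C f \<longleftrightarrow> f \<in> Arr C \<and>
     (\<exists>g \<in> Hom C (Cod C f) (Dom C f).
        g \<cdot>\<^bsub>C\<^esub> f = Ide C (Dom C f) \<and> f \<cdot>\<^bsub>C\<^esub> g = Ide C (Cod C f))"

definition is_initial :: "('o, 'a, 'z) category_scheme \<Rightarrow> 'o \<Rightarrow> bool" where
  "is_initial C Z \<longleftrightarrow> Z \<in> Obj C \<and> (\<forall>X \<in> Obj C. \<exists>!f. f \<in> Hom C Z X)"

definition is_functor ::
  "('j, 'u, 'y) category_scheme \<Rightarrow> ('o, 'a, 'z) category_scheme
    \<Rightarrow> ('j \<Rightarrow> 'o) \<Rightarrow> ('u \<Rightarrow> 'a) \<Rightarrow> bool" where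
  "is_functor J C D d \<longleftrightarrow>
     (\<forall>j \<in> Obj J. D j \<in> Obj C) \<and>
     (\<forall>u \<in> Arr J. d u \<in> Hom C (D (Dom J u)) (D (Cod J u))) \<and>
     (\<forall>j \<in> Obj J. d (Ide J j) = Ide C (D j)) \<and>
     (\<forall>u \<in> Arr J. \<forall>v \<in> Arr J. Cod J u = Dom J v \<longrightarrow>
        d (v \<cdot>\<^bsub>J\<^esub> u) = d v \<cdot>\<^bsub>C\<^esub> d u)"

definition is_cone ::
  "('j, 'u, 'y) category_scheme \<Rightarrow> ('o, 'a, 'z) category_scheme
    \<Rightarrow> ('j \<Rightarrow> 'o) \<Rightarrow> ('u \<Rightarrow> 'a) \<Rightarrow> 'o \<Rightarrow> ('j \<Rightarrow> 'a) \<Rightarrow> bool" where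
  "is_cone J C D d L p \<longleftrightarrow> L \<in> Obj C \<and>
     (\<forall>j \<in> Obj J. p j \<in> Hom C L (D j)) \<and>
     (\<forall>u \<in> Arr J. d u \<cdot>\<^bsub>C\<^esub> p (Dom J u) = p (Cod J u))"

definition is_limit ::
  "('j, 'u, 'y) category_scheme \<Rightarrow> ('o, 'a, 'z) category_scheme
    \<Rightarrow> ('j \<Rightarrow> 'o) \<Rightarrow> ('u \<Rightarrow> 'a) \<Rightarrow> 'o \<Rightarrow> ('j \<Rightarrow> 'a) \<Rightarrow> bool" where
  "is_limit J C D d L p \<longleftrightarrow> is_cone J C D d L p \<and>
     (\<forall>K q. is_cone J C D d K q \<longrightarrow>
        (\<exists>!h. h \<in> Hom C K L \<and> (\<forall>j \<in> Obj J. p j \<cdot>\<^bsub>C\<^esub> h = q j)))"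

text \<open>Every finite category is isomorphic to one whose objects and arrows are natural numbers,
  so quantifying over the latter covers all finite diagrams.\<close>

definition finitely_complete :: "('o, 'a, 'z) category_scheme \<Rightarrow> bool" where
  "finitely_complete C \<longleftrightarrow>
     (\<forall>(J :: (nat, nat) category) D d.
        category J \<and> finite (Obj J) \<and> finite (Arr J) \<and> is_functor J C D d \<longrightarrow>
        (\<exists>L p. is_limit J C D d L p))"

definition is_coproduct ::
  "('o, 'a, 'z) category_scheme \<Rightarrow> 'i set \<Rightarrow> ('i \<Rightarrow> 'o) \<Rightarrow> 'o \<Rightarrow> ('i \<Rightarrow> 'a) \<Rightarrow> bool" where
  "is_coproduct C I F S k \<longleftrightarrow> S \<in> Obj C \<and>
     (\<forall>i \<in> I. k i \<in> Hom C (F i) S) \<and>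
     (\<forall>T \<in> Obj C. \<forall>q. (\<forall>i \<in> I. q i \<in> Hom C (F i) T) \<longrightarrow>
        (\<exists>!h. h \<in> Hom C S T \<and> (\<forall>i \<in> I. h \<cdot>\<^bsub>C\<^esub> k i = q i)))"

definition has_finite_coproducts :: "('o, 'a, 'z) category_scheme \<Rightarrow> bool" where
  "has_finite_coproducts C \<longleftrightarrow>
     (\<forall>(I :: nat set) F. finite I \<and> (\<forall>i \<in> I. F i \<in> Obj C) \<longrightarrow>
        (\<exists>S k. is_coproduct C I F S k))"

text \<open>The square with top \<open>q : P \<rightarrow> Dom n\<close>, left side \<open>p : P \<rightarrow> Dom f\<close>,
  bottom \<open>f\<close> and right side \<open>n\<close>.\<close>

definition is_pullback ::
  "('o, 'a, 'z) category_scheme \<Rightarrow> 'a \<Rightarrow> 'a \<Rightarrow> 'a \<Rightarrow> 'a \<Rightarrow> bool" where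
  "is_pullback C f n p q \<longleftrightarrow> f \<in> Arr C \<and> n \<in> Arr C \<and> Cod C f = Cod C n \<and>
     p \<in> Arr C \<and> q \<in> Hom C (Dom C p) (Dom C n) \<and> Cod C p = Dom C f \<and>
     f \<cdot>\<^bsub>C\<^esub> p = n \<cdot>\<^bsub>C\<^esub> q \<and>
     (\<forall>W. \<forall>a \<in> Hom C W (Dom C f). \<forall>b \<in> Hom C W (Dom C n).
        f \<cdot>\<^bsub>C\<^esub> a = n \<cdot>\<^bsub>C\<^esub> b \<longrightarrow>
        (\<exists>!h. h \<in> Hom C W (Dom C p) \<and> p \<cdot>\<^bsub>C\<^esub> h = a \<and> q \<cdot>\<^bsub>C\<^esub> h = b))"


section \<open>Contexts and admissible subobjects\<close>

record ('o, 'a) fs_category = "('o, 'a) category" +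
  Ecls :: "'a set"
  Mcls :: "'a set"

locale proper_factorization_system = category A
  for A :: "('o, 'a, 'z) fs_category_scheme" (structure) +
  assumes E_epi: "e \<in> Ecls A \<Longrightarrow> is_epi A e"
    and M_mono: "m \<in> Mcls A \<Longrightarrow> is_mono A m"
    and iso_E: "is_iso A i \<Longrightarrow> i \<in> Ecls A"
    and iso_M: "is_iso A i \<Longrightarrow> i \<in> Mcls A"
    and E_Comp: "e \<in> Ecls A \<Longrightarrow> e' \<in> Ecls A \<Longrightarrow> Cod A e = Dom A e' \<Longrightarrow> e' \<cdot> e \<in> Ecls A"
    and M_Comp: "m \<in> Mcls A \<Longrightarrow> m' \<in> Mcls A \<Longrightarrow> Cod A m = Dom A m' \<Longrightarrow> m' \<cdot> m \<in> Mcls A"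
    and factorization: "f \<in> Arr A \<Longrightarrow>
      \<exists>e \<in> Ecls A. \<exists>m \<in> Mcls A. Cod A e = Dom A m \<and> f = m \<cdot> e"
    and diagonal: "e \<in> Ecls A \<Longrightarrow> m \<in> Mcls A \<Longrightarrow>
      u \<in> Hom A (Dom A e) (Dom A m) \<Longrightarrow> v \<in> Hom A (Cod A e) (Cod A m) \<Longrightarrow>
      v \<cdot> e = m \<cdot> u \<Longrightarrow>
      \<exists>!w. w \<in> Hom A (Cod A e) (Dom A m) \<and> w \<cdot> e = u \<and> m \<cdot> w = v"

definition admissible :: "('o, 'a, 'z) fs_category_scheme \<Rightarrow> 'o \<Rightarrow> 'a set" where
  "admissible A X = {m \<in> Mcls A. Cod A m = X}"

definition factors_through :: "('o, 'a, 'z) fs_category_scheme \<Rightarrow> 'a \<Rightarrow> 'a \<Rightarrow> bool" where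
  "factors_through A m n \<longleftrightarrow> (\<exists>h \<in> Hom A (Dom A m) (Dom A n). m = n \<cdot>\<^bsub>A\<^esub> h)"

definition sub_equiv :: "('o, 'a, 'z) fs_category_scheme \<Rightarrow> 'o \<Rightarrow> ('a \<times> 'a) set" where
  "sub_equiv A X = {(m, n). m \<in> admissible A X \<and> n \<in> admissible A X \<and>
     factors_through A m n \<and> factors_through A n m}"

text \<open>A subobject is an equivalence class, that is, a set of arrows.\<close>

definition Sub :: "('o, 'a, 'z) fs_category_scheme \<Rightarrow> 'o \<Rightarrow> 'a set set" where
  "Sub A X = admissible A X // sub_equiv A X"

definition SubL :: "('o, 'a, 'z) fs_category_scheme \<Rightarrow> 'o \<Rightarrow> 'a set gorder" where
  "SubL A X = \<lparr>carrier = Sub A X, eq = (=),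
     le = (\<lambda>c d. \<exists>m \<in> c. \<exists>n \<in> d. factors_through A m n)\<rparr>"

locale nbhd_context = proper_factorization_system A
  for A :: "('o, 'a, 'z) fs_category_scheme" (structure) +
  assumes fin_complete: "finitely_complete A"
    and fin_coproducts: "has_finite_coproducts A"
    and Sub_complete: "X \<in> Obj A \<Longrightarrow> complete_lattice (SubL A X)"

text \<open>The \<open>\<M>\<close>-part of a factorization is determined up to isomorphism only; the set of all
  of them is an equivalence class, hence a subobject. The same applies to pullbacks of
  \<open>\<M>\<close>-morphisms, which are again \<open>\<M>\<close>-morphisms.\<close>

definition M_parts :: "('o, 'a, 'z) fs_category_scheme \<Rightarrow> 'a \<Rightarrow> 'a set" where
  "M_parts A g = {n \<in> Mcls A. \<exists>e \<in> Ecls A. Cod A e = Dom A n \<and> g = n \<cdot>\<^bsub>A\<^esub> e}"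

definition sub_zero :: "('o, 'a, 'z) fs_category_scheme \<Rightarrow> 'o \<Rightarrow> 'a set" where
  "sub_zero A X = (\<Union>Z \<in> {Z. is_initial A Z}. \<Union>i \<in> Hom A Z X. M_parts A i)"

definition sub_image :: "('o, 'a, 'z) fs_category_scheme \<Rightarrow> 'a \<Rightarrow> 'a set \<Rightarrow> 'a set" where
  "sub_image A f c = (\<Union>m \<in> c. M_parts A (f \<cdot>\<^bsub>A\<^esub> m))"

definition sub_preimage :: "('o, 'a, 'z) fs_category_scheme \<Rightarrow> 'a \<Rightarrow> 'a set \<Rightarrow> 'a set" where
  "sub_preimage A f d = {p. \<exists>n \<in> d. \<exists>q. is_pullback A f n p q}"

definition Frobenius :: "('o, 'a, 'z) fs_category_scheme \<Rightarrow> 'a \<Rightarrow> bool" where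
  "Frobenius A f \<longleftrightarrow> f \<in> Arr A \<and>
     (\<forall>x \<in> Sub A (Dom A f). \<forall>y \<in> Sub A (Cod A f).
        sub_image A f (x \<sqinter>\<^bsub>SubL A (Dom A f)\<^esub> sub_preimage A f y)
          = y \<sqinter>\<^bsub>SubL A (Cod A f)\<^esub> sub_image A f x)"

definition reflects_zero :: "('o, 'a, 'z) fs_category_scheme \<Rightarrow> 'a \<Rightarrow> bool" where
  "reflects_zero A f \<longleftrightarrow> f \<in> Arr A \<and>
     sub_preimage A f (sub_zero A (Cod A f)) = sub_zero A (Dom A f)"


section \<open>Preneighbourhood systems and closures\<close>

text \<open>The empty meet is included, so a filter contains the largest subobject; the improper
  filter \<open>Sub A X\<close> is allowed.\<close>

definition Fil :: "('o, 'a, 'z) fs_category_scheme \<Rightarrow> 'o \<Rightarrow> 'a set set set" where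
  "Fil A X = {F. F \<subseteq> Sub A X \<and>
     (\<forall>x \<in> F. \<forall>y \<in> Sub A X. x \<sqsubseteq>\<^bsub>SubL A X\<^esub> y \<longrightarrow> y \<in> F) \<and>
     (\<forall>S. finite S \<and> S \<subseteq> F \<longrightarrow> \<Sqinter>\<^bsub>SubL A X\<^esub> S \<in> F)}"

definition preneighbourhood_system ::
  "('o, 'a, 'z) fs_category_scheme \<Rightarrow> 'o \<Rightarrow> ('a set \<Rightarrow> 'a set set) \<Rightarrow> bool" where
  "preneighbourhood_system A X \<mu> \<longleftrightarrow> X \<in> Obj A \<and>
     (\<forall>m \<in> Sub A X. \<mu> m \<in> Fil A X) \<and>
     (\<forall>m \<in> Sub A X. \<forall>n \<in> Sub A X. m \<sqsubseteq>\<^bsub>SubL A X\<^esub> n \<longrightarrow> \<mu> n \<subseteq> \<mu> m) \<and>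
     \<mu> (sub_zero A X) = Sub A X \<and>
     (\<forall>m \<in> Sub A X. \<forall>p \<in> \<mu> m. m \<sqsubseteq>\<^bsub>SubL A X\<^esub> p)"

definition filter_pullback ::
  "('o, 'a, 'z) fs_category_scheme \<Rightarrow> 'a \<Rightarrow> 'a set set \<Rightarrow> 'a set set" where
  "filter_pullback A f B = {x \<in> Sub A (Dom A f).
     \<exists>b \<in> B. sub_preimage A f b \<sqsubseteq>\<^bsub>SubL A (Dom A f)\<^esub> x}"

definition nbhd_pullback ::
  "('o, 'a, 'z) fs_category_scheme \<Rightarrow> 'a \<Rightarrow> ('a set \<Rightarrow> 'a set set) \<Rightarrow> 'a set \<Rightarrow> 'a set set" where
  "nbhd_pullback A f \<phi> x = filter_pullback A f (\<phi> (sub_image A f x))"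

definition Far ::
  "('o, 'a, 'z) fs_category_scheme \<Rightarrow> 'o \<Rightarrow> ('a set \<Rightarrow> 'a set set) \<Rightarrow> 'a set \<Rightarrow> 'a set set" where
  "Far A X \<mu> p = {x \<in> Sub A X. \<exists>u \<in> \<mu> x. u \<sqinter>\<^bsub>SubL A X\<^esub> p = sub_zero A X}"

definition cl ::
  "('o, 'a, 'z) fs_category_scheme \<Rightarrow> 'o \<Rightarrow> ('a set \<Rightarrow> 'a set set) \<Rightarrow> 'a set \<Rightarrow> 'a set" where
  "cl A X \<mu> p = \<Squnion>\<^bsub>SubL A X\<^esub>
     {x \<in> Sub A X. \<not> p \<sqsubset>\<^bsub>SubL A X\<^esub> x \<and> x \<notin> Far A X \<mu> p}"

definition closed_subs ::
  "('o, 'a, 'z) fs_category_scheme \<Rightarrow> 'o \<Rightarrow> ('a set \<Rightarrow> 'a set set) \<Rightarrow> 'a set set" where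
  "closed_subs A X \<mu> = {p \<in> Sub A X. cl A X \<mu> p = p}"

definition cl_hat ::
  "('o, 'a, 'z) fs_category_scheme \<Rightarrow> 'o \<Rightarrow> ('a set \<Rightarrow> 'a set set) \<Rightarrow> 'a set \<Rightarrow> 'a set" where
  "cl_hat A X \<mu> p = \<Sqinter>\<^bsub>SubL A X\<^esub> {t \<in> closed_subs A X \<mu>. p \<sqsubseteq>\<^bsub>SubL A X\<^esub> t}"

text \<open>The requirement that \<open>\<mu>\<close> and \<open>\<phi>\<close> be preneighbourhood systems is part of membership.\<close>

definition Cl ::
  "('o, 'a, 'z) fs_category_scheme \<Rightarrow> 'o \<Rightarrow> ('a set \<Rightarrow> 'a set set)
    \<Rightarrow> 'o \<Rightarrow> ('a set \<Rightarrow> 'a set set) \<Rightarrow> 'a set" where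
  "Cl A X \<mu> Y \<phi> = {f \<in> Hom A X Y.
     preneighbourhood_system A X \<mu> \<and> preneighbourhood_system A Y \<phi> \<and>
     (\<forall>x \<in> Sub A X. nbhd_pullback A f \<phi> x \<subseteq> \<mu> x) \<and>
     (\<forall>p \<in> Sub A X. cl_hat A Y \<phi> (sub_image A f p)
        \<sqsubseteq>\<^bsub>SubL A Y\<^esub> sub_image A f (cl_hat A X \<mu> p))}"

end

theory Submission
  imports Defs
begin

text \<open>
  Write \<open>f\<^sub>*\<close> for the image and \<open>f\<^sup>*\<close> for the preimage along \<open>f\<close>, and \<open>\<mu>\<close> for the pulled back
  system. The closure \<open>cl\<close> is extensive and monotone, so every \<open>cl_hat \<mu> p\<close> is itself closed
  (\<open>cl_hat_closed\<close>). Since \<open>cl_hat \<phi> (f\<^sub>* p)\<close> is a lower bound of the closed subobjects above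
  \<open>f\<^sub>* p\<close>, it suffices that \<open>f\<^sub>*\<close> sends \<open>\<mu>\<close>-closed subobjects to \<open>\<phi>\<close>-closed ones (\<open>closed_image\<close>).

  Let \<open>s\<close> be \<open>\<mu>\<close>-closed and let \<open>y\<close> be one of the subobjects whose join is \<open>cl \<phi> (f\<^sub>* s)\<close>: it is
  not far from \<open>f\<^sub>* s\<close> and not strictly above it. As \<open>f\<close> is a Frobenius morphism in \<open>\<E>\<close>,
  \<open>f\<^sub>* (f\<^sup>* y) = y\<close> (\<open>E_image_preimage\<close>). Hence the \<open>\<mu>\<close>-neighbourhoods of \<open>f\<^sup>* y\<close> are generated
  by the \<open>f\<^sup>* v\<close> with \<open>v \<in> \<phi> y\<close>, and by the Frobenius law such an \<open>f\<^sup>* v\<close> can miss \<open>s\<close> only if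
  \<open>v\<close> misses \<open>f\<^sub>* s\<close> (\<open>Far_preimage\<close>). So \<open>f\<^sup>* y\<close> is not far from \<open>s\<close>. Either it lies strictly
  above \<open>s\<close>, and then \<open>f\<^sub>* s \<le> y\<close> by adjunction, which forces \<open>y = f\<^sub>* s\<close>; or it lies below
  \<open>cl \<mu> s = s\<close>, and then \<open>y = f\<^sub>* (f\<^sup>* y) \<le> f\<^sub>* s\<close>. In both cases \<open>y \<le> f\<^sub>* s\<close>.

  Reflection of zero enters through \<open>nbhd_pullback_preneighbourhood\<close>: it makes every subobject a
  \<open>\<mu>\<close>-neighbourhood of the smallest one. All these arguments take place in the subobject lattices
  and use the category only through the adjunction between \<open>f\<^sub>*\<close> and \<open>f\<^sup>*\<close>
  (\<open>image_preimage_adjunction\<close>), the leastness of the zero subobject (\<open>sub_zero_least\<close>), and the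
  fact that an arrow of \<open>\<E>\<close> has the largest subobject as its image.
\<close>

section \<open>Subobjects as equivalence classes\<close>

context proper_factorization_system
begin

lemma E_Hom: "e \<in> Ecls A \<Longrightarrow> e \<in> Hom A (Dom A e) (Cod A e)"
  using E_epi by (auto simp: is_epi_def Hom_def)

lemma M_Hom: "m \<in> Mcls A \<Longrightarrow> m \<in> Hom A (Dom A m) (Cod A m)"
  using M_mono by (auto simp: is_mono_def Hom_def)

lemma E_cancel:
  "e \<in> Ecls A \<Longrightarrow> g \<in> Hom A (Cod A e) W \<Longrightarrow> h \<in> Hom A (Cod A e) W \<Longrightarrow> g \<cdot> e = h \<cdot> e \<Longrightarrow> g = h"
  using E_epi unfolding is_epi_def by blast

lemma M_cancel:
  "m \<in> Mcls A \<Longrightarrow> g \<in> Hom A W (Dom A m) \<Longrightarrow> h \<in> Hom A W (Dom A m) \<Longrightarrow> m \<cdot> g = m \<cdot> h \<Longrightarrow> g = h"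
  using M_mono unfolding is_mono_def by blast

lemma Ide_iso: "X \<in> Obj A \<Longrightarrow> is_iso A (Ide A X)"
  using Ide_in_Hom[of X] Comp_Ide[of "Ide A X" X X]
  unfolding is_iso_def Hom_def by auto

lemma factors_refl: "m \<in> Mcls A \<Longrightarrow> factors_through A m m"
  using Comp_Ide[OF M_Hom] Ide_in_Hom[OF Dom_in_Obj] M_Hom
  unfolding factors_through_def Hom_def by force

lemma factors_trans:
  assumes "factors_through A l m" "factors_through A m n" "n \<in> Mcls A"
  shows "factors_through A l n"
proof -
  obtain h k where "h \<in> Hom A (Dom A l) (Dom A m)" "l = m \<cdot> h"
    "k \<in> Hom A (Dom A m) (Dom A n)" "m = n \<cdot> k"
    using assms unfolding factors_through_def by blast
  then have "k \<cdot> h \<in> Hom A (Dom A l) (Dom A n)" "l = n \<cdot> (k \<cdot> h)"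
    using Comp_in_Hom Comp_assoc M_Hom[OF assms(3)] by metis+
  then show ?thesis unfolding factors_through_def by blast
qed

text \<open>Orthogonality is used almost only in this form: it says that the image of an arrow
  is the least admissible subobject through which that arrow factors.\<close>

lemma image_least:
  assumes "e \<in> Ecls A" "k \<in> Mcls A" "n \<in> Mcls A" "Cod A e = Dom A k" "Cod A k = Cod A n"
    and "u \<in> Hom A (Dom A e) (Dom A n)" "k \<cdot> e = n \<cdot> u"
  shows "factors_through A k n"
  using diagonal[OF assms(1,3,6), of k] M_Hom[OF assms(2)] assms
  unfolding factors_through_def by metis

lemma equiv_sub_equiv: "equiv (admissible A X) (sub_equiv A X)"
proof (rule equivI)
  show "refl_on (admissible A X) (sub_equiv A X)"
    using factors_refl by (auto simp: refl_on_def sub_equiv_def admissible_def)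
  show "sym (sub_equiv A X)" by (auto simp: sym_def sub_equiv_def)
  show "trans (sub_equiv A X)"
    using factors_trans unfolding trans_def sub_equiv_def admissible_def by blast
  show "sub_equiv A X \<subseteq> admissible A X \<times> admissible A X" by (auto simp: sub_equiv_def)
qed

lemma Sub_nonempty: "c \<in> Sub A X \<Longrightarrow> \<exists>m. m \<in> c"
  using in_quotient_imp_non_empty[OF equiv_sub_equiv] unfolding Sub_def by blast

lemma Sub_member:
  assumes "c \<in> Sub A X" "m \<in> c"
  shows "m \<in> Mcls A" "Cod A m = X" "m \<in> Hom A (Dom A m) X"
proof -
  have "m \<in> admissible A X"
    using in_quotient_imp_subset[OF equiv_sub_equiv] assms unfolding Sub_def by blast
  then show "m \<in> Mcls A" "Cod A m = X" "m \<in> Hom A (Dom A m) X"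
    using M_Hom by (auto simp: admissible_def)
qed

lemma Sub_factors:
  assumes "c \<in> Sub A X" "m \<in> c" "n \<in> c"
  shows "factors_through A m n"
  using in_quotient_imp_in_rel[OF equiv_sub_equiv, of c X m n] assms
  unfolding Sub_def sub_equiv_def by auto

lemma Sub_eqI:
  assumes "n \<in> c" "\<And>m. m \<in> c \<longleftrightarrow> m \<in> Mcls A \<and> Cod A m = X \<and>
    factors_through A n m \<and> factors_through A m n"
  shows "c \<in> Sub A X"
proof -
  have "c = sub_equiv A X `` {n}"
    using assms by (auto simp: sub_equiv_def admissible_def)
  moreover have "n \<in> admissible A X" using assms by (auto simp: admissible_def)
  ultimately show ?thesis unfolding Sub_def by (simp add: quotientI)
qed

lemma carrier_SubL [simp]: "carrier (SubL A X) = Sub A X"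
  by (simp add: SubL_def)

lemma eq_SubL [simp]: "eq (SubL A X) = (=)"
  by (simp add: SubL_def)

text \<open>The order on classes is defined by some pair of representatives; any pair decides it.\<close>

lemma Sub_le_iff:
  assumes "c \<in> Sub A X" "d \<in> Sub A X" "m \<in> c" "n \<in> d"
  shows "c \<sqsubseteq>\<^bsub>SubL A X\<^esub> d \<longleftrightarrow> factors_through A m n"
proof -
  have "factors_through A m n" if "m' \<in> c" "n' \<in> d" "factors_through A m' n'" for m' n'
    using that assms Sub_factors Sub_member factors_trans by meson
  then show ?thesis using assms by (auto simp: SubL_def)
qed

section \<open>Images\<close>

lemma mutual_factors_iso:
  assumes "m \<in> Mcls A" "n \<in> Mcls A" "factors_through A m n" "factors_through A n m"
  obtains h where "h \<in> Hom A (Dom A m) (Dom A n)" "is_iso A h" "m = n \<cdot> h"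
proof -
  obtain h k where h: "h \<in> Hom A (Dom A m) (Dom A n)" "m = n \<cdot> h"
    and k: "k \<in> Hom A (Dom A n) (Dom A m)" "n = m \<cdot> k"
    using assms(3,4) unfolding factors_through_def by blast
  have kh: "k \<cdot> h \<in> Hom A (Dom A m) (Dom A m)" and hk: "h \<cdot> k \<in> Hom A (Dom A n) (Dom A n)"
    using h k Comp_in_Hom by blast+
  note m = M_Hom[OF assms(1)] and n = M_Hom[OF assms(2)]
  have id: "Ide A (Dom A m) \<in> Hom A (Dom A m) (Dom A m)"
    "Ide A (Dom A n) \<in> Hom A (Dom A n) (Dom A n)"
    using m n Dom_in_Obj Ide_in_Hom by (auto simp: Hom_def)
  have "m \<cdot> (k \<cdot> h) = m" using h k m Comp_assoc by metis
  then have 1: "k \<cdot> h = Ide A (Dom A m)"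
    using M_cancel[OF assms(1) kh id(1)] Comp_Ide[OF m] by simp
  have "n \<cdot> (h \<cdot> k) = n" using h k n Comp_assoc by metis
  then have 2: "h \<cdot> k = Ide A (Dom A n)"
    using M_cancel[OF assms(2) hk id(2)] Comp_Ide[OF n] by simp
  have "is_iso A h" using h(1) k(1) 1 2 unfolding is_iso_def Hom_def by auto
  then show ?thesis using that h by blast
qed

lemma M_partsE:
  assumes "n \<in> M_parts A g" "g \<in> Hom A W X"
  obtains e where "n \<in> Mcls A" "Cod A n = X" "e \<in> Ecls A" "e \<in> Hom A W (Dom A n)" "g = n \<cdot> e"
proof -
  obtain e where e: "n \<in> Mcls A" "e \<in> Ecls A" "Cod A e = Dom A n" "g = n \<cdot> e"
    using assms unfolding M_parts_def by blast
  have "e \<in> Hom A (Dom A e) (Dom A n)" using E_Hom[OF e(2)] e(3) by simp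
  moreover from this have "g \<in> Hom A (Dom A e) (Cod A n)"
    using e(4) M_Hom[OF e(1)] Comp_in_Hom by blast
  ultimately show ?thesis using that e assms(2) by (auto simp: Hom_def)
qed

text \<open>Orthogonality makes any two \<open>\<M>\<close>-parts of \<open>g\<close> equivalent, and \<open>\<E>\<close> absorbs isomorphisms, so
  \<open>M_parts\<close> is the whole equivalence class and not merely a part of one.\<close>

lemma M_parts_Sub:
  assumes g: "g \<in> Hom A W X"
  shows "M_parts A g \<in> Sub A X"
proof -
  obtain n where n: "n \<in> M_parts A g"
    using factorization[of g] g unfolding M_parts_def Hom_def by auto
  from n g obtain e where e: "n \<in> Mcls A" "Cod A n = X" "e \<in> Ecls A" "e \<in> Hom A W (Dom A n)"
    "g = n \<cdot> e" by (rule M_partsE)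
  show ?thesis
  proof (rule Sub_eqI[OF n], intro iffI conjI)
    fix m assume m: "m \<in> M_parts A g"
    from m g obtain d where d: "m \<in> Mcls A" "Cod A m = X" "d \<in> Ecls A" "d \<in> Hom A W (Dom A m)"
      "g = m \<cdot> d" by (rule M_partsE)
    show "m \<in> Mcls A" "Cod A m = X" by fact+
    show "factors_through A n m"
      by (rule image_least[of e _ _ d]) (use d e in \<open>auto simp: Hom_def\<close>)
    show "factors_through A m n"
      by (rule image_least[of d _ _ e]) (use d e in \<open>auto simp: Hom_def\<close>)
  next
    fix m assume m: "m \<in> Mcls A \<and> Cod A m = X \<and> factors_through A n m \<and> factors_through A m n"
    then obtain h where h: "h \<in> Hom A (Dom A n) (Dom A m)" "is_iso A h" "n = m \<cdot> h"
      using mutual_factors_iso[OF e(1), of m] by blast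
    have "h \<cdot> e \<in> Ecls A" using E_Comp[OF e(3) iso_E[OF h(2)]] e(4) h(1) by (auto simp: Hom_def)
    moreover have "Cod A (h \<cdot> e) = Dom A m" using Comp_in_Hom[OF e(4) h(1)] by (auto simp: Hom_def)
    moreover have "g = m \<cdot> (h \<cdot> e)"
      using e(5) h(3) Comp_assoc[OF e(4) h(1), of m X] M_Hom m by metis
    ultimately show "m \<in> M_parts A g" using m unfolding M_parts_def by blast
  qed
qed

lemma M_parts_iso_subset:
  assumes g: "g \<in> Hom A V X" and h: "h \<in> Hom A W V" "is_iso A h"
  shows "M_parts A g \<subseteq> M_parts A (g \<cdot> h)"
proof
  fix n assume n: "n \<in> M_parts A g"
  from n g obtain e where e: "n \<in> Mcls A" "Cod A n = X" "e \<in> Ecls A" "e \<in> Hom A V (Dom A n)"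
    "g = n \<cdot> e" by (rule M_partsE)
  have "e \<cdot> h \<in> Ecls A" using E_Comp[OF iso_E[OF h(2)] e(3)] e(4) h(1) by (auto simp: Hom_def)
  moreover have "Cod A (e \<cdot> h) = Dom A n" using Comp_in_Hom[OF h(1) e(4)] by (auto simp: Hom_def)
  moreover have "g \<cdot> h = n \<cdot> (e \<cdot> h)"
    using e(5) Comp_assoc[OF h(1) e(4) M_Hom[OF e(1)]] by simp
  ultimately show "n \<in> M_parts A (g \<cdot> h)" using e(1) unfolding M_parts_def by blast
qed

text \<open>Equivalent representatives differ by an isomorphism of their domains, so the union that
  defines the image collapses to the contribution of a single representative.\<close>

lemma sub_image_eq:
  assumes f: "f \<in> Hom A X Y" and c: "c \<in> Sub A X" and m: "m \<in> c"
  shows "sub_image A f c = M_parts A (f \<cdot> m)"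
proof -
  have "M_parts A (f \<cdot> n) \<subseteq> M_parts A (f \<cdot> m)" if n: "n \<in> c" for n
  proof -
    obtain h where h: "h \<in> Hom A (Dom A m) (Dom A n)" "is_iso A h" "m = n \<cdot> h"
      using mutual_factors_iso Sub_member(1)[OF c] Sub_factors[OF c] m n by metis
    have "f \<cdot> n \<in> Hom A (Dom A n) Y" using Comp_in_Hom f Sub_member(3)[OF c n] by blast
    moreover have "f \<cdot> m = (f \<cdot> n) \<cdot> h" using Comp_assoc[OF h(1) Sub_member(3)[OF c n] f] h(3) by simp
    ultimately show ?thesis using M_parts_iso_subset[OF _ h(1,2)] by metis
  qed
  then show ?thesis using m unfolding sub_image_def by blast
qed

lemma sub_image_Sub:
  assumes f: "f \<in> Hom A X Y" and c: "c \<in> Sub A X"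
  shows "sub_image A f c \<in> Sub A Y"
proof -
  obtain m where m: "m \<in> c" using Sub_nonempty[OF c] by blast
  show ?thesis unfolding sub_image_eq[OF f c m]
    using M_parts_Sub[OF Comp_in_Hom[OF Sub_member(3)[OF c m] f]] .
qed

section \<open>Pullbacks and preimages\<close>

lemma pullback_mono:
  assumes pb: "is_pullback A f n p q" and n: "n \<in> Mcls A"
    and g: "g \<in> Hom A W (Dom A p)" and h: "h \<in> Hom A W (Dom A p)" and eq: "p \<cdot> g = p \<cdot> h"
  shows "g = h"
proof -
  have f: "f \<in> Hom A (Dom A f) (Cod A n)" and p: "p \<in> Hom A (Dom A p) (Dom A f)"
    and q: "q \<in> Hom A (Dom A p) (Dom A n)" and sq: "f \<cdot> p = n \<cdot> q"
    and U: "\<And>W a b. a \<in> Hom A W (Dom A f) \<Longrightarrow> b \<in> Hom A W (Dom A n) \<Longrightarrow> f \<cdot> a = n \<cdot> b \<Longrightarrow>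
        \<exists>!h. h \<in> Hom A W (Dom A p) \<and> p \<cdot> h = a \<and> q \<cdot> h = b"
    using pb unfolding is_pullback_def Hom_def by auto
  note nH = M_Hom[OF n]
  have comm: "f \<cdot> (p \<cdot> k) = n \<cdot> (q \<cdot> k)" if k: "k \<in> Hom A W (Dom A p)" for k
    using Comp_assoc[OF k p f] Comp_assoc[OF k q nH] sq by simp
  have 1: "q \<cdot> g = q \<cdot> h"
    using M_cancel[OF n Comp_in_Hom[OF g q] Comp_in_Hom[OF h q]] comm[OF g] comm[OF h] eq by simp
  from U[OF Comp_in_Hom[OF g p] Comp_in_Hom[OF g q] comm[OF g]] show ?thesis
    using g h eq 1 by auto
qed

text \<open>Stability of \<open>\<M>\<close> under pullback. Factor \<open>p = m \<cdot> e\<close>. Orthogonality of \<open>e\<close> and \<open>n\<close> turns \<open>m\<close>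
  into one leg of a cone over the cospan, so \<open>m\<close> factors through \<open>p\<close>; as \<open>p\<close> is monic and
  \<open>e\<close> epic, the factor is inverse to \<open>e\<close>.\<close>

lemma pullback_M:
  assumes pb: "is_pullback A f n p q" and n: "n \<in> Mcls A"
  shows "p \<in> Mcls A"
proof -
  have f: "f \<in> Hom A (Dom A f) (Cod A n)" and p: "p \<in> Hom A (Dom A p) (Dom A f)"
    and q: "q \<in> Hom A (Dom A p) (Dom A n)" and sq: "f \<cdot> p = n \<cdot> q"
    and U: "\<And>W a b. a \<in> Hom A W (Dom A f) \<Longrightarrow> b \<in> Hom A W (Dom A n) \<Longrightarrow> f \<cdot> a = n \<cdot> b \<Longrightarrow>
        \<exists>!h. h \<in> Hom A W (Dom A p) \<and> p \<cdot> h = a \<and> q \<cdot> h = b"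
    using pb unfolding is_pullback_def Hom_def by auto
  obtain m where "m \<in> M_parts A p" using Sub_nonempty M_parts_Sub[OF p] by blast
  then obtain e where e: "m \<in> Mcls A" "Cod A m = Dom A f" "e \<in> Ecls A"
    "e \<in> Hom A (Dom A p) (Dom A m)" "p = m \<cdot> e"
    using p by (rule M_partsE)
  have mH: "m \<in> Hom A (Dom A m) (Dom A f)" using M_Hom[OF e(1)] e(2) by simp
  have De: "Dom A e = Dom A p" "Cod A e = Dom A m" using e(4) by (auto simp: Hom_def)
  have "(f \<cdot> m) \<cdot> e = n \<cdot> q" using Comp_assoc[OF e(4) mH f] e(5) sq by simp
  then obtain w where w: "w \<in> Hom A (Dom A m) (Dom A n)" "n \<cdot> w = f \<cdot> m"
    using diagonal[OF e(3) n, of q "f \<cdot> m"] q Comp_in_Hom[OF mH f] De by auto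
  obtain h where h: "h \<in> Hom A (Dom A m) (Dom A p)" "p \<cdot> h = m"
    using U[OF mH w(1)] w(2) by auto
  have id: "Ide A (Dom A p) \<in> Hom A (Dom A p) (Dom A p)" "Ide A (Dom A m) \<in> Hom A (Dom A m) (Dom A m)"
    using Ide_in_Hom Dom_in_Obj p mH by (auto simp: Hom_def)
  have he: "h \<cdot> e \<in> Hom A (Dom A p) (Dom A p)" and eh: "e \<cdot> h \<in> Hom A (Dom A m) (Dom A m)"
    using Comp_in_Hom h(1) e(4) by blast+
  have "p \<cdot> (h \<cdot> e) = p" using Comp_assoc[OF e(4) h(1) p] h(2) e(5) by simp
  then have 1: "h \<cdot> e = Ide A (Dom A p)"
    using pullback_mono[OF pb n he id(1)] Comp_Ide[OF p] by simp
  have "(e \<cdot> h) \<cdot> e = e" using Comp_assoc[OF e(4) h(1) e(4)] 1 Comp_Ide[OF e(4)] by simp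
  then have 2: "e \<cdot> h = Ide A (Dom A m)"
    using E_cancel[OF e(3)] eh id(2) Ide_Comp[OF e(4)] De by metis
  have "is_iso A e" using 1 2 e(4) h(1) unfolding is_iso_def Hom_def by auto
  then show ?thesis using M_Comp[OF iso_M e(1)] De e(5) by simp
qed

end

text \<open>Each object is named like its identity, and the arrows 3 and 4 go from 0 and 1, respectively,
  to 2. In a composable pair with second arrow 0, 1 or 2 that arrow is an identity, and otherwise
  the first arrow is one; hence the formula for composition.\<close>

definition cospan :: "(nat, nat) category" where
  "cospan = \<lparr>Obj = {0,1,2}, Arr = {0,1,2,3,4},
     Dom = (\<lambda>a. if a = 3 then 0 else if a = 4 then 1 else a),
     Cod = (\<lambda>a. if a \<ge> 3 then 2 else a), Ide = (\<lambda>j. j),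
     Comp = (\<lambda>g f. if g < 3 then f else g)\<rparr>"

lemma cospan_composable:
  assumes "u \<in> Arr cospan" "v \<in> Arr cospan" "Cod cospan u = Dom cospan v"
  shows "(u, v) \<in> {(0,0), (1,1), (2,2), (0,3), (1,4), (3,2), (4,2)}"
proof -
  have "u \<in> {0,1,2,3,4}" "v \<in> {0,1,2,3,4}" using assms by (simp_all add: cospan_def)
  then show ?thesis using assms(3) unfolding cospan_def by (elim insertE emptyE; simp)
qed

lemma category_cospan: "category cospan"
proof
  fix f g X Y Z assume fg: "f \<in> Hom cospan X Y" "g \<in> Hom cospan Y Z"
  show "g \<cdot>\<^bsub>cospan\<^esub> f \<in> Hom cospan X Z"
  proof -
    have "(f, g) \<in> {(0,0), (1,1), (2,2), (0,3), (1,4), (3,2), (4,2)}"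
      using fg by (intro cospan_composable) (auto simp: Hom_def)
    then show ?thesis using fg unfolding Hom_def by (elim insertE emptyE; simp add: cospan_def)
  qed
next
  fix f g h X Y Z W
  show "(h \<cdot>\<^bsub>cospan\<^esub> g) \<cdot>\<^bsub>cospan\<^esub> f = h \<cdot>\<^bsub>cospan\<^esub> (g \<cdot>\<^bsub>cospan\<^esub> f)" by (simp add: cospan_def)
next
  fix f X Y assume "f \<in> Hom cospan X Y"
  then show "f \<cdot>\<^bsub>cospan\<^esub> Ide cospan X = f" by (auto simp: cospan_def Hom_def)
next
  fix f X Y assume "f \<in> Hom cospan X Y"
  then show "Ide cospan Y \<cdot>\<^bsub>cospan\<^esub> f = f" by (auto simp: cospan_def Hom_def)
next
  fix f assume "f \<in> Arr cospan"
  then show "Dom cospan f \<in> Obj cospan" "Cod cospan f \<in> Obj cospan" by (auto simp: cospan_def)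
next
  fix X assume "X \<in> Obj cospan"
  then show "Ide cospan X \<in> Hom cospan X X" by (auto simp: cospan_def Hom_def)
qed

context nbhd_context
begin

lemma pullback_exists:
  assumes f: "f \<in> Hom A X Y" and n: "n \<in> Hom A N Y"
  obtains p q where "is_pullback A f n p q"
proof -
  \<comment> \<open>The limit of this cospan diagram has a redundant third projection, to \<open>Y\<close>.\<close>
  define D where "D j = (if j = (0::nat) then X else if j = 1 then N else Y)" for j
  define d where "d u = (if u = (3::nat) then f else if u = 4 then n else Ide A (D u))" for u
  have fA: "f \<in> Arr A" "Dom A f = X" "Cod A f = Y" and nA: "n \<in> Arr A" "Dom A n = N" "Cod A n = Y"
    using f n by (auto simp: Hom_def)
  have Ob: "X \<in> Obj A" "Y \<in> Obj A" "N \<in> Obj A"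
    using fA nA Dom_in_Obj Cod_in_Obj by blast+
  have I: "Ide A Z \<in> Hom A Z Z" "Ide A Z \<cdot> Ide A Z = Ide A Z" if "Z \<in> {X, Y, N}" for Z
    using that Ob Ide_in_Hom Ide_Comp by blast+
  have "is_functor cospan A D d"
    unfolding is_functor_def
  proof (intro conjI ballI impI)
    show "D j \<in> Obj A" for j using Ob by (simp add: D_def)
    show "d u \<in> Hom A (D (Dom cospan u)) (D (Cod cospan u))" if "u \<in> Arr cospan" for u
      using that by (auto simp: cospan_def D_def d_def I f n)
    show "d (Ide cospan j) = Ide A (D j)" if "j \<in> Obj cospan" for j
      using that by (auto simp: cospan_def d_def D_def)
    show "d (v \<cdot>\<^bsub>cospan\<^esub> u) = d v \<cdot> d u"
      if "u \<in> Arr cospan" "v \<in> Arr cospan" "Cod cospan u = Dom cospan v" for u v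
      using cospan_composable[OF that] unfolding insert_iff empty_iff prod.inject
      by (elim disjE conjE FalseE; simp add: cospan_def D_def d_def I Comp_Ide[OF f] Comp_Ide[OF n]
        Ide_Comp[OF f] Ide_Comp[OF n])
  qed
  moreover have "finite (Obj cospan)" "finite (Arr cospan)" by (simp_all add: cospan_def)
  ultimately obtain L p where lim: "is_limit cospan A D d L p"
    using fin_complete category_cospan unfolding finitely_complete_def by blast
  have L: "L \<in> Obj A" "p 0 \<in> Hom A L X" "p 1 \<in> Hom A L N" "p 2 \<in> Hom A L Y"
      "f \<cdot> p 0 = p 2" "n \<cdot> p 1 = p 2"
    using lim unfolding is_limit_def is_cone_def by (auto simp: cospan_def D_def d_def)
  have LU: "\<exists>!h. h \<in> Hom A K L \<and> (\<forall>j \<in> Obj cospan. p j \<cdot> h = q j)"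
    if "is_cone cospan A D d K q" for K q
    using lim that unfolding is_limit_def by blast
  have "is_pullback A f n (p 0) (p 1)"
    unfolding is_pullback_def
  proof (intro conjI allI ballI impI)
    fix W a b
    assume a: "a \<in> Hom A W (Dom A f)" and b: "b \<in> Hom A W (Dom A n)" and eq: "f \<cdot> a = n \<cdot> b"
    define q where "q j = (if j = (0::nat) then a else if j = 1 then b else f \<cdot> a)" for j
    have ab: "a \<in> Hom A W X" "b \<in> Hom A W N" "f \<cdot> a \<in> Hom A W Y"
      using a b fA nA Comp_in_Hom f by auto
    have "W \<in> Obj A" using ab(1) Dom_in_Obj by (auto simp: Hom_def)
    then have "is_cone cospan A D d W q"
      unfolding is_cone_def using ab eq
      by (auto simp: cospan_def D_def d_def q_def Ide_Comp[OF ab(1)] Ide_Comp[OF ab(2)]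
        Ide_Comp[OF ab(3)[unfolded eq]])
    from LU[OF this] have "\<exists>!h. h \<in> Hom A W L \<and> (\<forall>j \<in> Obj cospan. p j \<cdot> h = q j)" .
    moreover have "(\<forall>j \<in> Obj cospan. p j \<cdot> h = q j) \<longleftrightarrow> p 0 \<cdot> h = a \<and> p 1 \<cdot> h = b"
      if "h \<in> Hom A W L" for h
      using Comp_assoc[OF that L(2) f] L(5) by (auto simp: cospan_def q_def)
    ultimately have "\<exists>!h. h \<in> Hom A W L \<and> p 0 \<cdot> h = a \<and> p 1 \<cdot> h = b"
      by (simp cong: conj_cong)
    then show "\<exists>!h. h \<in> Hom A W (Dom A (p 0)) \<and> p 0 \<cdot> h = a \<and> p 1 \<cdot> h = b"
      using L(2) by (simp add: Hom_def)
  qed (use L fA nA in \<open>auto simp: Hom_def\<close>)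
  then show ?thesis using that by blast
qed

lemma pullback_transport:
  assumes pb: "is_pullback A f n p q" and n: "n \<in> Mcls A" and m: "m \<in> Mcls A"
    "factors_through A p m" "factors_through A m p"
  shows "\<exists>r. is_pullback A f n m r"
proof -
  have f: "f \<in> Hom A (Dom A f) (Cod A n)" and p: "p \<in> Hom A (Dom A p) (Dom A f)"
    and q: "q \<in> Hom A (Dom A p) (Dom A n)" and sq: "f \<cdot> p = n \<cdot> q"
    and U: "\<And>W a b. a \<in> Hom A W (Dom A f) \<Longrightarrow> b \<in> Hom A W (Dom A n) \<Longrightarrow> f \<cdot> a = n \<cdot> b \<Longrightarrow>
        \<exists>!h. h \<in> Hom A W (Dom A p) \<and> p \<cdot> h = a \<and> q \<cdot> h = b"
    using pb unfolding is_pullback_def Hom_def by auto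
  obtain k where k: "k \<in> Hom A (Dom A m) (Dom A p)" "m = p \<cdot> k"
    using m unfolding factors_through_def by blast
  obtain h where h: "h \<in> Hom A (Dom A p) (Dom A m)" "p = m \<cdot> h"
    using m unfolding factors_through_def by blast
  have mH: "m \<in> Hom A (Dom A m) (Dom A f)" using Comp_in_Hom[OF k(1) p] k(2) by simp
  have r: "q \<cdot> k \<in> Hom A (Dom A m) (Dom A n)" using Comp_in_Hom[OF k(1) q] .
  have eq: "f \<cdot> m = n \<cdot> (q \<cdot> k)"
    using Comp_assoc[OF k(1) p f] Comp_assoc[OF k(1) q M_Hom[OF n]] k(2) sq by simp
  have "is_pullback A f n m (q \<cdot> k)"
    unfolding is_pullback_def
  proof (intro conjI allI ballI impI)
    fix W a b
    assume a: "a \<in> Hom A W (Dom A f)" and b: "b \<in> Hom A W (Dom A n)" and ab: "f \<cdot> a = n \<cdot> b"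
    obtain w where w: "w \<in> Hom A W (Dom A p)" "p \<cdot> w = a" using U[OF a b ab] by blast
    have hw: "h \<cdot> w \<in> Hom A W (Dom A m)" using Comp_in_Hom[OF w(1) h(1)] .
    have mhw: "m \<cdot> (h \<cdot> w) = a" using Comp_assoc[OF w(1) h(1) mH] h(2) w(2) by simp
    have "(q \<cdot> k) \<cdot> x = b" if x: "x \<in> Hom A W (Dom A m)" "m \<cdot> x = a" for x
    proof -
      have "n \<cdot> ((q \<cdot> k) \<cdot> x) = f \<cdot> (m \<cdot> x)"
        using Comp_assoc[OF x(1) r M_Hom[OF n]] Comp_assoc[OF x(1) mH f] eq by simp
      then show ?thesis using x(2) ab M_cancel[OF n Comp_in_Hom[OF x(1) r] b] by simp
    qed
    then show "\<exists>!x. x \<in> Hom A W (Dom A m) \<and> m \<cdot> x = a \<and> (q \<cdot> k) \<cdot> x = b"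
      using hw mhw M_cancel[OF m(1)] by metis
  qed (use f mH r eq M_Hom[OF n] in \<open>auto simp: Hom_def\<close>)
  then show ?thesis by blast
qed

text \<open>Since \<open>n\<close> is monic, the universal property needs to be tested on one leg only. This is the
  representative form of the adjunction between image and preimage.\<close>

lemma pullback_factors:
  assumes pb: "is_pullback A f n p q" and n: "n \<in> Mcls A"
    and m: "m \<in> Hom A (Dom A m) (Dom A f)"
  shows "factors_through A m p \<longleftrightarrow> factors_through A (f \<cdot> m) n"
proof -
  have f: "f \<in> Hom A (Dom A f) (Cod A n)" and p: "p \<in> Hom A (Dom A p) (Dom A f)"
    and q: "q \<in> Hom A (Dom A p) (Dom A n)" and sq: "f \<cdot> p = n \<cdot> q"
    and U: "\<And>W a b. a \<in> Hom A W (Dom A f) \<Longrightarrow> b \<in> Hom A W (Dom A n) \<Longrightarrow> f \<cdot> a = n \<cdot> b \<Longrightarrow>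
        \<exists>!h. h \<in> Hom A W (Dom A p) \<and> p \<cdot> h = a \<and> q \<cdot> h = b"
    using pb unfolding is_pullback_def Hom_def by auto
  have D: "Dom A (f \<cdot> m) = Dom A m" using Comp_in_Hom[OF m f] by (simp add: Hom_def)
  show ?thesis
  proof
    assume "factors_through A m p"
    then obtain h where h: "h \<in> Hom A (Dom A m) (Dom A p)" "m = p \<cdot> h"
      unfolding factors_through_def by blast
    have "f \<cdot> m = n \<cdot> (q \<cdot> h)"
      using Comp_assoc[OF h(1) p f] Comp_assoc[OF h(1) q M_Hom[OF n]] h(2) sq by simp
    then show "factors_through A (f \<cdot> m) n"
      using Comp_in_Hom[OF h(1) q] D unfolding factors_through_def by auto
  next
    assume "factors_through A (f \<cdot> m) n"
    then obtain h where h: "h \<in> Hom A (Dom A m) (Dom A n)" "f \<cdot> m = n \<cdot> h"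
      using D unfolding factors_through_def by auto
    then show "factors_through A m p" using U[OF m h] unfolding factors_through_def by blast
  qed
qed

text \<open>By \<open>pullback_factors\<close> the pullbacks of equivalent arrows are equivalent, and by
  \<open>pullback_transport\<close> an arrow equivalent to a pullback is one; so the preimage is exactly one
  equivalence class.\<close>

lemma sub_preimage_Sub:
  assumes f: "f \<in> Hom A X Y" and d: "d \<in> Sub A Y"
  shows "sub_preimage A f d \<in> Sub A X"
proof -
  have Df: "Dom A f = X" using f by (simp add: Hom_def)
  obtain n where n: "n \<in> d" using Sub_nonempty[OF d] by blast
  note nM = Sub_member[OF d]
  obtain p q where pb: "is_pullback A f n p q" using pullback_exists[OF f nM(3)[OF n]] .
  have pM: "p' \<in> Mcls A" "Cod A p' = X" "p' \<in> Hom A (Dom A p') (Dom A f)"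
    if "is_pullback A f n' p' q'" "n' \<in> d" for n' p' q'
    using pullback_M[OF that(1) nM(1)[OF that(2)]] that(1) Df
    by (auto simp: is_pullback_def Hom_def)
  have le: "factors_through A p1 p2"
    if 1: "is_pullback A f n1 p1 q1" "n1 \<in> d" and 2: "is_pullback A f n2 p2 q2" "n2 \<in> d"
    for n1 p1 q1 n2 p2 q2
  proof -
    have "factors_through A (f \<cdot> p1) n1"
      using pullback_factors[OF 1(1) nM(1)[OF 1(2)] pM(3)[OF 1]] factors_refl[OF pM(1)[OF 1]] by simp
    then have "factors_through A (f \<cdot> p1) n2"
      using factors_trans Sub_factors[OF d 1(2) 2(2)] nM(1)[OF 2(2)] by blast
    then show ?thesis using pullback_factors[OF 2(1) nM(1)[OF 2(2)] pM(3)[OF 1]] by simp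
  qed
  have p: "p \<in> sub_preimage A f d" using pb n unfolding sub_preimage_def by blast
  show ?thesis
  proof (rule Sub_eqI[OF p], intro iffI)
    fix m assume "m \<in> sub_preimage A f d"
    then obtain n' q' where "is_pullback A f n' m q'" "n' \<in> d" unfolding sub_preimage_def by blast
    then show "m \<in> Mcls A \<and> Cod A m = X \<and> factors_through A p m \<and> factors_through A m p"
      using pM le pb n by blast
  next
    fix m assume "m \<in> Mcls A \<and> Cod A m = X \<and> factors_through A p m \<and> factors_through A m p"
    then show "m \<in> sub_preimage A f d"
      using pullback_transport[OF pb nM(1)[OF n]] n unfolding sub_preimage_def by blast
  qed
qed

text \<open>Images are left adjoint to preimages: for representatives \<open>m\<close> and \<open>n\<close>, both inequalities say
  that \<open>f \<cdot> m\<close> factors through \<open>n\<close>, the left one by orthogonality and the right one by the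
  universal property of the pullback.\<close>

lemma image_preimage_adjunction:
  assumes f: "f \<in> Hom A X Y" and c: "c \<in> Sub A X" and d: "d \<in> Sub A Y"
  shows "sub_image A f c \<sqsubseteq>\<^bsub>SubL A Y\<^esub> d \<longleftrightarrow> c \<sqsubseteq>\<^bsub>SubL A X\<^esub> sub_preimage A f d"
proof -
  have Df: "Dom A f = X" using f by (simp add: Hom_def)
  obtain m where m: "m \<in> c" using Sub_nonempty[OF c] by blast
  note mM = Sub_member[OF c m]
  have fm: "f \<cdot> m \<in> Hom A (Dom A m) Y" using Comp_in_Hom[OF mM(3) f] .
  obtain k where k: "k \<in> M_parts A (f \<cdot> m)" using Sub_nonempty M_parts_Sub[OF fm] by blast
  then obtain e where e: "k \<in> Mcls A" "Cod A k = Y" "e \<in> Ecls A" "e \<in> Hom A (Dom A m) (Dom A k)"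
    "f \<cdot> m = k \<cdot> e" using fm by (rule M_partsE)
  have kc: "k \<in> sub_image A f c" using k sub_image_eq[OF f c m] by simp
  obtain p where p: "p \<in> sub_preimage A f d" using Sub_nonempty[OF sub_preimage_Sub[OF f d]] by blast
  then obtain n q where n: "n \<in> d" and pb: "is_pullback A f n p q" unfolding sub_preimage_def by blast
  note nM = Sub_member[OF d n]
  have D: "Dom A (f \<cdot> m) = Dom A m" using fm by (simp add: Hom_def)
  have "sub_image A f c \<sqsubseteq>\<^bsub>SubL A Y\<^esub> d \<longleftrightarrow> factors_through A k n"
    using Sub_le_iff[OF sub_image_Sub[OF f c] d kc n] .
  also have "\<dots> \<longleftrightarrow> factors_through A (f \<cdot> m) n"
  proof
    assume "factors_through A k n"
    moreover have "factors_through A (f \<cdot> m) k" using e D unfolding factors_through_def by auto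
    ultimately show "factors_through A (f \<cdot> m) n" using factors_trans nM(1) by blast
  next
    assume "factors_through A (f \<cdot> m) n"
    then obtain u where "u \<in> Hom A (Dom A m) (Dom A n)" "f \<cdot> m = n \<cdot> u"
      using D unfolding factors_through_def by auto
    then show "factors_through A k n"
      using e nM by (intro image_least[of e k n u]) (auto simp: Hom_def)
  qed
  also have "\<dots> \<longleftrightarrow> factors_through A m p"
    using pullback_factors[OF pb nM(1)] mM(3) Df by simp
  also have "\<dots> \<longleftrightarrow> c \<sqsubseteq>\<^bsub>SubL A X\<^esub> sub_preimage A f d"
    using Sub_le_iff[OF c sub_preimage_Sub[OF f d] m p] by simp
  finally show ?thesis .
qed

section \<open>The smallest subobject\<close>

text \<open>An initial object is a coproduct of the empty family.\<close>

lemma initial_exists: "\<exists>Z. is_initial A Z"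
proof -
  obtain S k where "is_coproduct A ({} :: nat set) (\<lambda>_. undefined) S k"
    using fin_coproducts unfolding has_finite_coproducts_def by blast
  then show ?thesis unfolding is_coproduct_def is_initial_def by auto
qed

lemma initial_iso:
  assumes "is_initial A Z" "is_initial A Z'" "h \<in> Hom A Z Z'"
  shows "is_iso A h"
proof -
  obtain k where k: "k \<in> Hom A Z' Z" using assms unfolding is_initial_def by blast
  have "k \<cdot> h \<in> Hom A Z Z" "h \<cdot> k \<in> Hom A Z' Z'" using k assms(3) Comp_in_Hom by blast+
  moreover have "Ide A Z \<in> Hom A Z Z" "Ide A Z' \<in> Hom A Z' Z'"
    using assms Ide_in_Hom unfolding is_initial_def by blast+
  ultimately have "k \<cdot> h = Ide A Z" "h \<cdot> k = Ide A Z'"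
    using assms unfolding is_initial_def by blast+
  then show ?thesis using k assms(3) unfolding is_iso_def Hom_def by auto
qed

lemma sub_zero_eq:
  assumes Z: "is_initial A Z" and i: "i \<in> Hom A Z X"
  shows "sub_zero A X = M_parts A i"
proof -
  have X: "X \<in> Obj A" using i Cod_in_Obj by (auto simp: Hom_def)
  have "M_parts A i' \<subseteq> M_parts A i" if Z': "is_initial A Z'" and i': "i' \<in> Hom A Z' X" for Z' i'
  proof -
    obtain h where h: "h \<in> Hom A Z Z'" using Z Z' unfolding is_initial_def by blast
    have "i' \<cdot> h = i" using Z X i Comp_in_Hom[OF h i'] unfolding is_initial_def by blast
    then show ?thesis using M_parts_iso_subset[OF i' h initial_iso[OF Z Z' h]] by simp
  qed
  then show ?thesis using Z i unfolding sub_zero_def by blast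
qed

lemma sub_zero_Sub: "X \<in> Obj A \<Longrightarrow> sub_zero A X \<in> Sub A X"
  using initial_exists sub_zero_eq M_parts_Sub unfolding is_initial_def by metis

lemma sub_zero_least:
  assumes c: "c \<in> Sub A X"
  shows "sub_zero A X \<sqsubseteq>\<^bsub>SubL A X\<^esub> c"
proof -
  obtain m where m: "m \<in> c" using Sub_nonempty[OF c] by blast
  note mM = Sub_member[OF c m]
  have X: "X \<in> Obj A" and D: "Dom A m \<in> Obj A" using mM Cod_in_Obj Dom_in_Obj by (auto simp: Hom_def)
  obtain Z where Z: "is_initial A Z" using initial_exists by blast
  obtain i u where i: "i \<in> Hom A Z X" and u: "u \<in> Hom A Z (Dom A m)"
    using Z X D unfolding is_initial_def by blast
  have iu: "i = m \<cdot> u" using Z X i Comp_in_Hom[OF u mM(3)] unfolding is_initial_def by blast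
  obtain s where s: "s \<in> M_parts A i" using Sub_nonempty M_parts_Sub[OF i] by blast
  then obtain e where e: "s \<in> Mcls A" "Cod A s = X" "e \<in> Ecls A" "e \<in> Hom A Z (Dom A s)" "i = s \<cdot> e"
    using i by (rule M_partsE)
  have "factors_through A s m"
    using e iu u mM by (intro image_least[of e s m u]) (auto simp: Hom_def)
  then show ?thesis using Sub_le_iff[OF sub_zero_Sub[OF X] c _ m] s sub_zero_eq[OF Z i] by simp
qed

section \<open>Closed subobjects\<close>

lemma preneighbourhood_systemD:
  assumes "preneighbourhood_system A X \<mu>"
  shows "X \<in> Obj A"
    and "m \<in> Sub A X \<Longrightarrow> \<mu> m \<in> Fil A X"
    and "m \<in> Sub A X \<Longrightarrow> u \<in> \<mu> m \<Longrightarrow> u \<in> Sub A X"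
    and "m \<in> Sub A X \<Longrightarrow> n \<in> Sub A X \<Longrightarrow> m \<sqsubseteq>\<^bsub>SubL A X\<^esub> n \<Longrightarrow> \<mu> n \<subseteq> \<mu> m"
    and "\<mu> (sub_zero A X) = Sub A X"
    and "m \<in> Sub A X \<Longrightarrow> u \<in> \<mu> m \<Longrightarrow> m \<sqsubseteq>\<^bsub>SubL A X\<^esub> u"
proof -
  show "u \<in> Sub A X" if "m \<in> Sub A X" "u \<in> \<mu> m"
    using assms that unfolding preneighbourhood_system_def Fil_def by blast
qed (use assms in \<open>auto simp: preneighbourhood_system_def\<close>)

context
  fixes X :: 'o and \<mu>
  assumes pre: "preneighbourhood_system A X \<mu>"
begin

interpretation L: complete_lattice "SubL A X"
  by (rule Sub_complete[OF preneighbourhood_systemD(1)[OF pre]])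

lemma cl_Sub: "cl A X \<mu> p \<in> Sub A X"
  unfolding cl_def using L.sup_closed by fastforce

lemma cl_upper:
  assumes "x \<in> Sub A X" "\<not> p \<sqsubset>\<^bsub>SubL A X\<^esub> x" "x \<notin> Far A X \<mu> p"
  shows "x \<sqsubseteq>\<^bsub>SubL A X\<^esub> cl A X \<mu> p"
  unfolding cl_def using assms by (intro L.sup_upper) auto

lemma cl_least:
  assumes "t \<in> Sub A X"
    and "\<And>x. x \<in> Sub A X \<Longrightarrow> \<not> p \<sqsubset>\<^bsub>SubL A X\<^esub> x \<Longrightarrow> x \<notin> Far A X \<mu> p \<Longrightarrow> x \<sqsubseteq>\<^bsub>SubL A X\<^esub> t"
  shows "cl A X \<mu> p \<sqsubseteq>\<^bsub>SubL A X\<^esub> t"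
  unfolding cl_def using assms by (intro L.sup_least) auto

text \<open>Every neighbourhood of \<open>p\<close> contains \<open>p\<close>, so \<open>p\<close> can be far from itself only if it is the
  smallest subobject.\<close>

lemma cl_extensive:
  assumes p: "p \<in> Sub A X"
  shows "p \<sqsubseteq>\<^bsub>SubL A X\<^esub> cl A X \<mu> p"
proof (cases "p \<in> Far A X \<mu> p")
  case True
  then obtain u where u: "u \<in> \<mu> p" "u \<sqinter>\<^bsub>SubL A X\<^esub> p = sub_zero A X" unfolding Far_def by blast
  note D = preneighbourhood_systemD[OF pre]
  have uS: "u \<in> Sub A X" and pu: "p \<sqsubseteq>\<^bsub>SubL A X\<^esub> u" using D(3,6) p u(1) by blast+
  have "p \<sqsubseteq>\<^bsub>SubL A X\<^esub> u \<sqinter>\<^bsub>SubL A X\<^esub> p" using L.meet_le[of p u p] p uS pu by simp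
  then show ?thesis
    using u(2) sub_zero_least[OF cl_Sub] L.le_trans[of p "sub_zero A X"] p cl_Sub sub_zero_Sub[OF D(1)] by simp
next
  case False
  then show ?thesis using p by (intro cl_upper) (auto simp: lless_def)
qed

lemma Far_antimono:
  assumes S: "p \<in> Sub A X" "t \<in> Sub A X" and le: "p \<sqsubseteq>\<^bsub>SubL A X\<^esub> t"
  shows "Far A X \<mu> t \<subseteq> Far A X \<mu> p"
proof
  fix x assume "x \<in> Far A X \<mu> t"
  then obtain u where x: "x \<in> Sub A X" and u: "u \<in> \<mu> x" "u \<sqinter>\<^bsub>SubL A X\<^esub> t = sub_zero A X"
    unfolding Far_def by blast
  note D = preneighbourhood_systemD[OF pre]
  have uS: "u \<in> Sub A X" using D(3) x u(1) by blast
  have "u \<sqinter>\<^bsub>SubL A X\<^esub> p \<sqsubseteq>\<^bsub>SubL A X\<^esub> u \<sqinter>\<^bsub>SubL A X\<^esub> t"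
    using uS S le L.meet_left[of u p] L.meet_right[of u p] L.meet_closed[of u p]
      L.le_trans[of "u \<sqinter>\<^bsub>SubL A X\<^esub> p" p t] by (intro L.meet_le) auto
  then have "u \<sqinter>\<^bsub>SubL A X\<^esub> p = sub_zero A X"
    using u(2) uS S L.meet_closed[of u p] sub_zero_least[of "u \<sqinter>\<^bsub>SubL A X\<^esub> p" X] sub_zero_Sub[OF D(1)]
      L.le_antisym[of "u \<sqinter>\<^bsub>SubL A X\<^esub> p" "sub_zero A X"] by simp
  then show "x \<in> Far A X \<mu> p" using x u(1) unfolding Far_def by blast
qed

text \<open>The side condition that \<open>x\<close> is not strictly above \<open>p\<close> does not break monotonicity: anything
  strictly above \<open>t\<close> is strictly above \<open>p \<le> t\<close>.\<close>

lemma cl_mono: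
  assumes S: "p \<in> Sub A X" "t \<in> Sub A X" and le: "p \<sqsubseteq>\<^bsub>SubL A X\<^esub> t"
  shows "cl A X \<mu> p \<sqsubseteq>\<^bsub>SubL A X\<^esub> cl A X \<mu> t"
proof (rule cl_least[OF cl_Sub])
  fix x assume x: "x \<in> Sub A X" "\<not> p \<sqsubset>\<^bsub>SubL A X\<^esub> x" "x \<notin> Far A X \<mu> p"
  have "\<not> t \<sqsubset>\<^bsub>SubL A X\<^esub> x"
    using x(1,2) S le L.le_trans[of p t x] L.le_antisym[of p t] by (auto simp: lless_def)
  then show "x \<sqsubseteq>\<^bsub>SubL A X\<^esub> cl A X \<mu> t" using x Far_antimono[OF S le] by (intro cl_upper) auto
qed

lemma closed_subsI:
  assumes "p \<in> Sub A X" "cl A X \<mu> p \<sqsubseteq>\<^bsub>SubL A X\<^esub> p"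
  shows "p \<in> closed_subs A X \<mu>"
  using assms cl_extensive[of p] cl_Sub[of p] L.le_antisym[of p "cl A X \<mu> p"]
  unfolding closed_subs_def by simp

lemma cl_hat_Sub: "cl_hat A X \<mu> p \<in> Sub A X"
  unfolding cl_hat_def closed_subs_def using L.inf_closed by fastforce

lemma cl_hat_lower:
  "t \<in> closed_subs A X \<mu> \<Longrightarrow> p \<sqsubseteq>\<^bsub>SubL A X\<^esub> t \<Longrightarrow> cl_hat A X \<mu> p \<sqsubseteq>\<^bsub>SubL A X\<^esub> t"
  unfolding cl_hat_def by (intro L.inf_lower) (auto simp: closed_subs_def)

lemma cl_hat_greatest:
  assumes "s \<in> Sub A X"
    and "\<And>t. t \<in> closed_subs A X \<mu> \<Longrightarrow> p \<sqsubseteq>\<^bsub>SubL A X\<^esub> t \<Longrightarrow> s \<sqsubseteq>\<^bsub>SubL A X\<^esub> t"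
  shows "s \<sqsubseteq>\<^bsub>SubL A X\<^esub> cl_hat A X \<mu> p"
  unfolding cl_hat_def using assms by (intro L.inf_greatest) (auto simp: closed_subs_def)

lemma cl_hat_extensive: "p \<in> Sub A X \<Longrightarrow> p \<sqsubseteq>\<^bsub>SubL A X\<^esub> cl_hat A X \<mu> p"
  by (intro cl_hat_greatest)

text \<open>A meet of closed subobjects is closed because \<open>cl\<close> is monotone.\<close>

lemma cl_hat_closed: "cl_hat A X \<mu> p \<in> closed_subs A X \<mu>"
proof (intro closed_subsI cl_hat_Sub cl_hat_greatest cl_Sub)
  fix t assume t: "t \<in> closed_subs A X \<mu>" "p \<sqsubseteq>\<^bsub>SubL A X\<^esub> t"
  then show "cl A X \<mu> (cl_hat A X \<mu> p) \<sqsubseteq>\<^bsub>SubL A X\<^esub> t"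
    using cl_mono[OF cl_hat_Sub _ cl_hat_lower[OF t]] unfolding closed_subs_def by auto
qed

end

section \<open>Transport along a morphism\<close>

lemma sub_preimage_mono:
  assumes f: "f \<in> Hom A X Y" and S: "c \<in> Sub A Y" "d \<in> Sub A Y" and le: "c \<sqsubseteq>\<^bsub>SubL A Y\<^esub> d"
  shows "sub_preimage A f c \<sqsubseteq>\<^bsub>SubL A X\<^esub> sub_preimage A f d"
proof -
  have "X \<in> Obj A" "Y \<in> Obj A" using f Dom_in_Obj Cod_in_Obj by (auto simp: Hom_def)
  then interpret LX: complete_lattice "SubL A X" + LY: complete_lattice "SubL A Y"
    by (auto intro: Sub_complete)
  note P = sub_preimage_Sub[OF f S(1)]
  have "sub_image A f (sub_preimage A f c) \<sqsubseteq>\<^bsub>SubL A Y\<^esub> c"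
    using image_preimage_adjunction[OF f P S(1)] LX.le_refl P by simp
  then have "sub_image A f (sub_preimage A f c) \<sqsubseteq>\<^bsub>SubL A Y\<^esub> d"
    using LY.le_trans[OF _ le] sub_image_Sub[OF f P] S by simp
  then show ?thesis using image_preimage_adjunction[OF f P S(2)] by simp
qed

lemma sub_image_mono:
  assumes f: "f \<in> Hom A X Y" and S: "c \<in> Sub A X" "d \<in> Sub A X" and le: "c \<sqsubseteq>\<^bsub>SubL A X\<^esub> d"
  shows "sub_image A f c \<sqsubseteq>\<^bsub>SubL A Y\<^esub> sub_image A f d"
proof -
  have "X \<in> Obj A" "Y \<in> Obj A" using f Dom_in_Obj Cod_in_Obj by (auto simp: Hom_def)
  then interpret LX: complete_lattice "SubL A X" + LY: complete_lattice "SubL A Y"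
    by (auto intro: Sub_complete)
  note I = sub_image_Sub[OF f S(2)]
  have "d \<sqsubseteq>\<^bsub>SubL A X\<^esub> sub_preimage A f (sub_image A f d)"
    using image_preimage_adjunction[OF f S(2) I] LY.le_refl I by simp
  then have "c \<sqsubseteq>\<^bsub>SubL A X\<^esub> sub_preimage A f (sub_image A f d)"
    using LX.le_trans[OF le] sub_preimage_Sub[OF f I] S by simp
  then show ?thesis using image_preimage_adjunction[OF f S(1) I] by simp
qed

lemma sub_image_zero:
  assumes f: "f \<in> Hom A X Y"
  shows "sub_image A f (sub_zero A X) = sub_zero A Y"
proof -
  have O: "X \<in> Obj A" "Y \<in> Obj A" using f Dom_in_Obj Cod_in_Obj by (auto simp: Hom_def)
  then interpret LY: complete_lattice "SubL A Y" by (intro Sub_complete)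
  note Z = sub_zero_Sub[OF O(1)] sub_zero_Sub[OF O(2)]
  have "sub_image A f (sub_zero A X) \<sqsubseteq>\<^bsub>SubL A Y\<^esub> sub_zero A Y"
    using image_preimage_adjunction[OF f Z] sub_zero_least[OF sub_preimage_Sub[OF f Z(2)]] by simp
  then show ?thesis
    using LY.le_antisym[OF _ sub_zero_least] sub_image_Sub[OF f Z(1)] Z(2) by simp
qed

text \<open>The Frobenius law at the largest subobject \<open>1\<close> gives \<open>f\<^sub>* (f\<^sup>* y) = y \<and> f\<^sub>* 1\<close>, and for
  \<open>f \<in> \<E>\<close> the trivial factorization \<open>f = id \<cdot> f\<close> shows \<open>f\<^sub>* 1 = 1\<close>.\<close>

lemma E_image_preimage:
  assumes f: "f \<in> Hom A X Y" and E: "f \<in> Ecls A" and Frob: "Frobenius A f" and y: "y \<in> Sub A Y"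
  shows "sub_image A f (sub_preimage A f y) = y"
proof -
  have O: "X \<in> Obj A" "Y \<in> Obj A" and D: "Dom A f = X" "Cod A f = Y"
    using f Dom_in_Obj Cod_in_Obj by (auto simp: Hom_def)
  then interpret LX: complete_lattice "SubL A X" + LY: complete_lattice "SubL A Y"
    by (auto intro: Sub_complete)
  define tX where "tX = M_parts A (Ide A X)"
  have tX: "tX \<in> Sub A X" "Ide A X \<in> tX"
  proof -
    show "tX \<in> Sub A X" using M_parts_Sub[OF Ide_in_Hom[OF O(1)]] by (simp add: tX_def)
    show "Ide A X \<in> tX" unfolding tX_def M_parts_def
      using iso_E iso_M Ide_iso[OF O(1)] Comp_Ide[OF Ide_in_Hom[OF O(1)]] Ide_in_Hom[OF O(1)]
      by (force simp: Hom_def)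
  qed
  have top: "c \<sqsubseteq>\<^bsub>SubL A Z\<^esub> t"
    if c: "c \<in> Sub A Z" and t: "t \<in> Sub A Z" "Ide A Z \<in> t" and Z: "Z \<in> Obj A" for c t Z
  proof -
    obtain m where m: "m \<in> c" using Sub_nonempty[OF c] by blast
    have "factors_through A m (Ide A Z)"
      using Ide_Comp Sub_member[OF c m] Ide_in_Hom[OF Z]
      unfolding factors_through_def Hom_def by force
    then show ?thesis using Sub_le_iff[OF c t(1) m t(2)] by simp
  qed
  have im: "Ide A Y \<in> sub_image A f tX"
    unfolding sub_image_eq[OF f tX] M_parts_def
    using E iso_M[OF Ide_iso[OF O(2)]] Comp_Ide[OF f] Ide_Comp[OF f] Ide_in_Hom[OF O(2)] D
    by (force simp: Hom_def)
  note S = sub_preimage_Sub[OF f y] and I = sub_image_Sub[OF f tX(1)]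
  have "tX \<sqinter>\<^bsub>SubL A X\<^esub> sub_preimage A f y = sub_preimage A f y"
  proof (rule LX.le_antisym)
    show "tX \<sqinter>\<^bsub>SubL A X\<^esub> sub_preimage A f y \<sqsubseteq>\<^bsub>SubL A X\<^esub> sub_preimage A f y"
      using LX.meet_right S tX by simp
    show "sub_preimage A f y \<sqsubseteq>\<^bsub>SubL A X\<^esub> tX \<sqinter>\<^bsub>SubL A X\<^esub> sub_preimage A f y"
      using LX.meet_le[of "sub_preimage A f y" tX "sub_preimage A f y"] top[OF S tX O(1)] S tX by simp
  qed (use S tX LX.meet_closed in auto)
  moreover have "y \<sqinter>\<^bsub>SubL A Y\<^esub> sub_image A f tX = y"
  proof (rule LY.le_antisym)
    show "y \<sqinter>\<^bsub>SubL A Y\<^esub> sub_image A f tX \<sqsubseteq>\<^bsub>SubL A Y\<^esub> y"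
      using LY.meet_left y I by simp
    show "y \<sqsubseteq>\<^bsub>SubL A Y\<^esub> y \<sqinter>\<^bsub>SubL A Y\<^esub> sub_image A f tX"
      using LY.meet_le[of y y "sub_image A f tX"] top[OF y I im O(2)] y I by simp
  qed (use y I LY.meet_closed in auto)
  ultimately show ?thesis using Frob tX(1) y D unfolding Frobenius_def by metis
qed

text \<open>Closure under finite meets: the meet \<open>c\<close> of chosen witnesses \<open>b x\<close> is a witness for the meet
  of the \<open>x\<close>, since preimages are monotone.\<close>

lemma filter_pullback_Fil:
  assumes f: "f \<in> Hom A X Y" and B: "B \<in> Fil A Y"
  shows "filter_pullback A f B \<in> Fil A X"
proof -
  have O: "X \<in> Obj A" "Y \<in> Obj A" and D: "Dom A f = X"
    using f Dom_in_Obj Cod_in_Obj by (auto simp: Hom_def)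
  then interpret LX: complete_lattice "SubL A X" + LY: complete_lattice "SubL A Y"
    by (auto intro: Sub_complete)
  have BS: "B \<subseteq> Sub A Y" and Binf: "\<And>S. finite S \<Longrightarrow> S \<subseteq> B \<Longrightarrow> \<Sqinter>\<^bsub>SubL A Y\<^esub> S \<in> B"
    using B unfolding Fil_def by auto
  show ?thesis unfolding Fil_def
  proof (intro CollectI conjI ballI allI impI)
    show "filter_pullback A f B \<subseteq> Sub A X" using D by (auto simp: filter_pullback_def)
  next
    fix x y assume x: "x \<in> filter_pullback A f B" and y: "y \<in> Sub A X" "x \<sqsubseteq>\<^bsub>SubL A X\<^esub> y"
    obtain b where b: "b \<in> B" "sub_preimage A f b \<sqsubseteq>\<^bsub>SubL A X\<^esub> x" and xS: "x \<in> Sub A X"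
      using x D unfolding filter_pullback_def by auto
    have "sub_preimage A f b \<sqsubseteq>\<^bsub>SubL A X\<^esub> y"
      using LX.le_trans[OF b(2) y(2)] sub_preimage_Sub[OF f] b(1) BS xS y(1) by auto
    then show "y \<in> filter_pullback A f B" using b(1) y(1) D unfolding filter_pullback_def by auto
  next
    fix S assume S: "finite S \<and> S \<subseteq> filter_pullback A f B"
    then have SS: "S \<subseteq> Sub A X" using D by (auto simp: filter_pullback_def)
    have "\<forall>x\<in>S. \<exists>b\<in>B. sub_preimage A f b \<sqsubseteq>\<^bsub>SubL A X\<^esub> x"
      using S D unfolding filter_pullback_def by blast
    then obtain b where b: "\<And>x. x \<in> S \<Longrightarrow> b x \<in> B"
      "\<And>x. x \<in> S \<Longrightarrow> sub_preimage A f (b x) \<sqsubseteq>\<^bsub>SubL A X\<^esub> x" by metis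
    let ?c = "\<Sqinter>\<^bsub>SubL A Y\<^esub> (b ` S)"
    have c: "?c \<in> B" using S b(1) by (intro Binf) auto
    have "sub_preimage A f ?c \<sqsubseteq>\<^bsub>SubL A X\<^esub> \<Sqinter>\<^bsub>SubL A X\<^esub> S"
    proof (rule LX.inf_greatest)
      fix x assume x: "x \<in> S"
      have "?c \<sqsubseteq>\<^bsub>SubL A Y\<^esub> b x" using x b(1) BS by (intro LY.inf_lower) auto
      then have "sub_preimage A f ?c \<sqsubseteq>\<^bsub>SubL A X\<^esub> sub_preimage A f (b x)"
        using c b(1)[OF x] BS by (intro sub_preimage_mono[OF f]) auto
      then show "sub_preimage A f ?c \<sqsubseteq>\<^bsub>SubL A X\<^esub> x"
        using LX.le_trans[OF _ b(2)[OF x]] sub_preimage_Sub[OF f]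
          subsetD[OF BS c] subsetD[OF BS b(1)[OF x]] subsetD[OF SS x] by simp
    qed (use SS sub_preimage_Sub[OF f] c BS in auto)
    then show "\<Sqinter>\<^bsub>SubL A X\<^esub> S \<in> filter_pullback A f B"
      using c SS LX.inf_closed[of S] D unfolding filter_pullback_def by auto
  qed
qed

lemma nbhd_pullback_preneighbourhood:
  assumes f: "f \<in> Hom A X Y" and rz: "reflects_zero A f" and pre: "preneighbourhood_system A Y \<phi>"
  shows "preneighbourhood_system A X (nbhd_pullback A f \<phi>)"
proof -
  have O: "X \<in> Obj A" "Y \<in> Obj A" and D: "Dom A f = X" "Cod A f = Y"
    using f Dom_in_Obj Cod_in_Obj by (auto simp: Hom_def)
  then interpret LX: complete_lattice "SubL A X" by (intro Sub_complete)
  note P = preneighbourhood_systemD[OF pre]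
  show ?thesis
    unfolding preneighbourhood_system_def
  proof (intro conjI ballI impI)
    show "nbhd_pullback A f \<phi> m \<in> Fil A X" if "m \<in> Sub A X" for m
      unfolding nbhd_pullback_def using filter_pullback_Fil[OF f P(2)] sub_image_Sub[OF f that] by blast
  next
    fix m n assume mn: "m \<in> Sub A X" "n \<in> Sub A X" "m \<sqsubseteq>\<^bsub>SubL A X\<^esub> n"
    show "nbhd_pullback A f \<phi> n \<subseteq> nbhd_pullback A f \<phi> m"
      unfolding nbhd_pullback_def filter_pullback_def
      using P(4)[OF _ _ sub_image_mono[OF f mn]] sub_image_Sub[OF f] mn by blast
  next
    have "sub_preimage A f (sub_zero A Y) = sub_zero A X" using rz D unfolding reflects_zero_def by simp
    then show "nbhd_pullback A f \<phi> (sub_zero A X) = Sub A X"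
      unfolding nbhd_pullback_def filter_pullback_def sub_image_zero[OF f] P(5) D
      using sub_zero_least by (auto intro!: bexI[OF _ sub_zero_Sub[OF O(2)]])
  next
    fix m p assume m: "m \<in> Sub A X" and p: "p \<in> nbhd_pullback A f \<phi> m"
    then obtain v where v: "v \<in> \<phi> (sub_image A f m)" "sub_preimage A f v \<sqsubseteq>\<^bsub>SubL A X\<^esub> p"
      and pS: "p \<in> Sub A X"
      using D unfolding nbhd_pullback_def filter_pullback_def by auto
    note I = sub_image_Sub[OF f m]
    have vS: "v \<in> Sub A Y" using P(3)[OF I v(1)] .
    have "m \<sqsubseteq>\<^bsub>SubL A X\<^esub> sub_preimage A f v"
      using P(6)[OF I v(1)] image_preimage_adjunction[OF f m vS] by simp
    then show "m \<sqsubseteq>\<^bsub>SubL A X\<^esub> p"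
      using LX.le_trans[OF _ v(2)] m pS sub_preimage_Sub[OF f vS] by simp
  qed (rule O)
qed

text \<open>A neighbourhood of \<open>f\<^sup>* y\<close> missing \<open>s\<close> contains some \<open>f\<^sup>* v\<close> with \<open>v \<in> \<phi> (f\<^sub>* (f\<^sup>* y)) = \<phi> y\<close>.
  Applying \<open>f\<^sub>*\<close> to \<open>s \<and> f\<^sup>* v = 0\<close>, the Frobenius law yields \<open>v \<and> f\<^sub>* s = 0\<close>.\<close>

lemma Far_preimage:
  assumes f: "f \<in> Hom A X Y" and E: "f \<in> Ecls A" and Frob: "Frobenius A f"
    and pre: "preneighbourhood_system A Y \<phi>"
    and s: "s \<in> Sub A X" and y: "y \<in> Sub A Y"
    and far: "sub_preimage A f y \<in> Far A X (nbhd_pullback A f \<phi>) s"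
  shows "y \<in> Far A Y \<phi> (sub_image A f s)"
proof -
  have O: "X \<in> Obj A" "Y \<in> Obj A" and D: "Dom A f = X" "Cod A f = Y"
    using f Dom_in_Obj Cod_in_Obj by (auto simp: Hom_def)
  then interpret LX: complete_lattice "SubL A X" by (intro Sub_complete)
  obtain u v where u: "u \<in> Sub A X" "u \<sqinter>\<^bsub>SubL A X\<^esub> s = sub_zero A X"
    and v: "v \<in> \<phi> y" "sub_preimage A f v \<sqsubseteq>\<^bsub>SubL A X\<^esub> u"
    using far D E_image_preimage[OF f E Frob y]
    unfolding Far_def nbhd_pullback_def filter_pullback_def by auto
  have vS: "v \<in> Sub A Y" using preneighbourhood_systemD(3)[OF pre y v(1)] .
  let ?w = "sub_preimage A f v"
  have w: "?w \<in> Sub A X" using sub_preimage_Sub[OF f vS] .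
  have ms: "s \<sqinter>\<^bsub>SubL A X\<^esub> ?w \<in> Sub A X" using LX.meet_closed[of s ?w] s w by simp
  have "s \<sqinter>\<^bsub>SubL A X\<^esub> ?w \<sqsubseteq>\<^bsub>SubL A X\<^esub> u"
    using LX.le_trans[OF LX.meet_right[of s ?w] v(2)] s w u(1) ms by simp
  then have "s \<sqinter>\<^bsub>SubL A X\<^esub> ?w \<sqsubseteq>\<^bsub>SubL A X\<^esub> u \<sqinter>\<^bsub>SubL A X\<^esub> s"
    using LX.meet_le[of "s \<sqinter>\<^bsub>SubL A X\<^esub> ?w" u s] LX.meet_left[of s ?w] s w u(1) ms by simp
  then have "s \<sqinter>\<^bsub>SubL A X\<^esub> ?w = sub_zero A X"
    using LX.le_antisym[OF _ sub_zero_least[OF ms]] u(2) ms sub_zero_Sub[OF O(1)] by simp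
  then have "v \<sqinter>\<^bsub>SubL A Y\<^esub> sub_image A f s = sub_zero A Y"
    using Frob s vS D sub_image_zero[OF f] unfolding Frobenius_def by metis
  then show ?thesis using y v(1) unfolding Far_def by blast
qed

text \<open>The heart of the proof: a subobject \<open>y\<close> contributing to the closure of \<open>f\<^sub>* s\<close> is recovered as
  the image of \<open>f\<^sup>* y\<close>, and \<open>f\<^sup>* y\<close> contributes to the closure of \<open>s\<close> unless \<open>y = f\<^sub>* s\<close>.\<close>

lemma closed_image:
  assumes f: "f \<in> Hom A X Y" and E: "f \<in> Ecls A" and Frob: "Frobenius A f"
    and rz: "reflects_zero A f" and pre: "preneighbourhood_system A Y \<phi>"
    and s: "s \<in> closed_subs A X (nbhd_pullback A f \<phi>)"
  shows "sub_image A f s \<in> closed_subs A Y \<phi>"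
proof -
  have O: "X \<in> Obj A" "Y \<in> Obj A" using f Dom_in_Obj Cod_in_Obj by (auto simp: Hom_def)
  then interpret LY: complete_lattice "SubL A Y" by (intro Sub_complete)
  note pX = nbhd_pullback_preneighbourhood[OF f rz pre]
  have sS: "s \<in> Sub A X" and cs: "cl A X (nbhd_pullback A f \<phi>) s = s"
    using s unfolding closed_subs_def by auto
  note I = sub_image_Sub[OF f sS]
  show ?thesis
  proof (rule closed_subsI[OF pre I], rule cl_least[OF pre I])
    fix y assume y: "y \<in> Sub A Y" "\<not> sub_image A f s \<sqsubset>\<^bsub>SubL A Y\<^esub> y" "y \<notin> Far A Y \<phi> (sub_image A f s)"
    note w = sub_preimage_Sub[OF f y(1)]
    have nf: "sub_preimage A f y \<notin> Far A X (nbhd_pullback A f \<phi>) s"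
      using Far_preimage[OF f E Frob pre sS y(1)] y(3) by blast
    show "y \<sqsubseteq>\<^bsub>SubL A Y\<^esub> sub_image A f s"
    proof (cases "s \<sqsubset>\<^bsub>SubL A X\<^esub> sub_preimage A f y")
      case True
      then have "sub_image A f s \<sqsubseteq>\<^bsub>SubL A Y\<^esub> y"
        using image_preimage_adjunction[OF f sS y(1)] by (simp add: lless_def)
      then have "sub_image A f s = y" using y(2) by (simp add: lless_def)
      then show ?thesis using LY.le_refl y(1) by simp
    next
      case False
      then have "sub_preimage A f y \<sqsubseteq>\<^bsub>SubL A X\<^esub> s" using cl_upper[OF pX w _ nf] cs by simp
      then show ?thesis
        using sub_image_mono[OF f w sS] E_image_preimage[OF f E Frob y(1)] by simp
    qed
  qed
qed

end

theorem mainTheorem12: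
  fixes A :: "('o, 'a) fs_category"
    and X Y :: 'o and f :: 'a and \<phi> :: "'a set \<Rightarrow> 'a set set"
  assumes "nbhd_context A"
    and "f \<in> Hom A X Y"
    and "f \<in> Ecls A"
    and "Frobenius A f"
    and "reflects_zero A f"
    and "preneighbourhood_system A Y \<phi>"
  shows "f \<in> Cl A X (nbhd_pullback A f \<phi>) Y \<phi>"
proof -
  interpret nbhd_context A by fact
  note pX = nbhd_pullback_preneighbourhood[OF assms(2,5,6)]
  have "cl_hat A Y \<phi> (sub_image A f p) \<sqsubseteq>\<^bsub>SubL A Y\<^esub> sub_image A f (cl_hat A X (nbhd_pullback A f \<phi>) p)"
    if p: "p \<in> Sub A X" for p
    using closed_image[OF assms(2-6) cl_hat_closed[OF pX]]
      sub_image_mono[OF assms(2) p cl_hat_Sub[OF pX] cl_hat_extensive[OF pX p]]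
    by (rule cl_hat_lower[OF assms(6)])
  then show ?thesis using assms(2,6) pX unfolding Cl_def by simp
qed

end
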